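(* Let $\lambda\in\mathbb{R}$ and $\omega>0$, let $Q$ be the quantile function of the generalized inverse Gaussian distribution with parameters $(\lambda,\eta,\omega)$, $\eta=1$, let $u_0\in(0,1)$ and $x_0=Q(u_0)$. Then in a neighbourhood of $u_0$ $$Q(u)=\sum_{n=0}^\infty q_n(u-u_0)^n,$$ where, if $\lambda\ne1$, $$q_n=\begin{cases}x_0,&n=0\\ \frac2nK_\lambda(\omega)\sum_{i=0}^{n-1}b_ic_{n-i-1},&n\ge1\end{cases},\qquad a_n=\begin{cases}\frac1{q_0},&n=0\\-\frac1{q_0}\sum_{i=1}^nq_ia_{n-i},&n\ge1\end{cases},$$ $$b_n=\begin{cases}e^{\frac\omega2(a_0+q_0)},&n=0\\ \frac{\omega}{2n}\sum_{i=1}^ni(a_i+q_i)b_{n-i},&n\ge1\end{cases},\qquad c_n=\begin{cases}q_0^{1-\lambda},&n=0\\ \frac1{q_0}\sum_{i=1}^n\left(\frac{(2-\lambda)i}n-1\right)q_ic_{n-i},&n\ge1\end{cases},$$ and, if $\lambda=1$, with $a_n$ and $b_n$ given by the same formulas, $$q_n=\begin{cases}x_0,&n=0\\ \frac2nK_1(\omega)b_{n-1},&n\ge1\end{cases}.$$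
   Context: $K_\nu$ denotes the modified Bessel function (of the second kind, also called of the third kind). The generalized inverse Gaussian distribution with parameters $(\lambda,\eta,\omega)$, $\eta=1$, has density $$f(x)=\frac{1}{2K_\lambda(\omega)}x^{\lambda-1}e^{-\frac\omega2\left(x^{-1}+x\right)},\quad x>0,$$ distribution function $F(x)=\int_0^xf(t)\,dt$ and quantile function $Q=F^{-1}:(0,1)\to(0,\infty)$. *)

theory Defs
  imports "HOL-Analysis.Analysis"
begin

(* Modified Bessel function of the second (or third) kind, real order and positive argument:
     K_nu(z) = integral_0^infinity exp (- z cosh t) cosh (nu t) dt,
   the classical integral, absolutely convergent for every real nu and every z > 0
   (integer orders included). *)
definition Bessel_K :: "real \<Rightarrow> real \<Rightarrow> real" where
  "Bessel_K \<nu> z = (LBINT t:{0<..}. exp (- z * cosh t) * cosh (\<nu> * t))"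

(* Generalized inverse Gaussian distribution with parameters (lam, 1, omega);
   the density formula is meant for x > 0. *)
definition gig_density :: "real \<Rightarrow> real \<Rightarrow> real \<Rightarrow> real" where
  "gig_density lam \<omega> x =
     1 / (2 * Bessel_K lam \<omega>) * x powr (lam - 1) * exp (- (\<omega> / 2) * (inverse x + x))"

definition gig_cdf :: "real \<Rightarrow> real \<Rightarrow> real \<Rightarrow> real" where
  "gig_cdf lam \<omega> x = (LBINT t:{0<..x}. gig_density lam \<omega> t)"

(* The inverse of F : (0,infinity) -> (0,1); only meaningful at arguments in (0,1). *)
definition gig_quantile :: "real \<Rightarrow> real \<Rightarrow> real \<Rightarrow> real" where
  "gig_quantile lam \<omega> = the_inv_into {0<..} (gig_cdf lam \<omega>)"

(* The coefficients depend on lam, omega and x0 = Q(u0). *)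
function gig_q gig_a gig_b gig_c :: "real \<Rightarrow> real \<Rightarrow> real \<Rightarrow> nat \<Rightarrow> real" where
  "gig_q lam \<omega> x0 n =
     (if n = 0 then x0
      else if lam = 1 then 2 / real n * Bessel_K 1 \<omega> * gig_b lam \<omega> x0 (n - 1)
      else 2 / real n * Bessel_K lam \<omega> *
             (\<Sum>i=0..n-1. gig_b lam \<omega> x0 i * gig_c lam \<omega> x0 (n - i - 1)))"
| "gig_a lam \<omega> x0 n =
     (if n = 0 then 1 / gig_q lam \<omega> x0 0
      else - (1 / gig_q lam \<omega> x0 0) * (\<Sum>i=1..n. gig_q lam \<omega> x0 i * gig_a lam \<omega> x0 (n - i)))"
| "gig_b lam \<omega> x0 n =
     (if n = 0 then exp (\<omega> / 2 * (gig_a lam \<omega> x0 0 + gig_q lam \<omega> x0 0))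
      else \<omega> / (2 * real n) *
             (\<Sum>i=1..n. real i * (gig_a lam \<omega> x0 i + gig_q lam \<omega> x0 i) * gig_b lam \<omega> x0 (n - i)))"
| "gig_c lam \<omega> x0 n =
     (if n = 0 then gig_q lam \<omega> x0 0 powr (1 - lam)
      else 1 / gig_q lam \<omega> x0 0 *
             (\<Sum>i=1..n. ((2 - lam) * real i / real n - 1) * gig_q lam \<omega> x0 i
                          * gig_c lam \<omega> x0 (n - i)))"
  by pat_completeness auto
termination
  by (relation "Wellfounded.measure (case_sum
        (case_sum (\<lambda>(_, _, _, n). 4 * n) (\<lambda>(_, _, _, n). 4 * n + 1))
        (case_sum (\<lambda>(_, _, _, n). 4 * n + 2) (\<lambda>(_, _, _, n). 4 * n + 3)))") auto

(* Each defining equation matches every n and would loop as a rewrite rule. *)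
declare gig_q.simps [simp del] gig_a.simps [simp del] gig_b.simps [simp del] gig_c.simps [simp del]

end

(* With x = exp t on (1,oo) and x = exp (-t) on (0,1) the two halves of the density integral add up
   to twice the Bessel integral, so F has range (0,1) and Q inverts it.  The density extends
   holomorphically to Re z > 0; so does F, as a primitive G, and G' does not vanish at x0.  Hence the
   local holomorphic inverse g of G agrees with Q on the reals near u0, which gives convergence.
   The coefficients follow by comparing power series in
     g' = 2 K exp (omega/2 (1/g + g)) g^(1-lam)
   where A = 1/g, B = exp (omega/2 (A + g)) and C = g^(1-lam) are determined by
     g A = 1,   B' = omega/2 (A + g)' B,   g C' = (1 - lam) g' C. *)
theory Submission
  imports Defs "HOL-Complex_Analysis.Complex_Analysis"
begin

unbundle no vec_syntax

section \<open>Integrability and positivity of the Bessel integral\<close>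

text \<open>Quadratic growth of \<open>cosh\<close> is all that is needed for
  \<open>exp (- \<omega> * cosh t)\<close> to outweigh every factor
  \<open>exp (a * t)\<close>.\<close>

lemma cosh_ge_quadratic:
  fixes t :: real assumes "t \<ge> 0"
  shows "t\<^sup>2 / 4 \<le> cosh t"
proof -
  have "1 + t + t\<^sup>2 / 2 \<le> exp t" using assms by (rule exp_lower_Taylor_quadratic)
  moreover have "exp (-t) > 0" by simp
  moreover have "2 * cosh t = exp t + exp (-t)" by (simp add: cosh_def)
  ultimately show ?thesis using assms by linarith
qed

lemma absolutely_integrable_Bessel_kernel:
  fixes \<omega> a :: real
  assumes "\<omega> > 0"
  shows "(\<lambda>t. exp (- \<omega> * cosh t) * exp (a * t)) absolutely_integrable_on {0<..}"
proof (rule measurable_bounded_by_integrable_imp_absolutely_integrable)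
  show "(\<lambda>t. exp (- \<omega> * cosh t) * exp (a * t)) \<in> borel_measurable (lebesgue_on {0<..})"
    by (intro continuous_imp_measurable_on_sets_lebesgue continuous_intros) auto
  have "(\<lambda>t. exp ((a+1)\<^sup>2 / \<omega>) * exp (- 1 * t)) integrable_on {0..}"
    by (rule integrable_on_mult_right[OF integrable_on_exp_minus_to_infinity]) simp
  then show "(\<lambda>t. exp ((a+1)\<^sup>2 / \<omega>) * exp (- 1 * t)) integrable_on {0<..}"
    by (rule integrable_spike_set) (rule negligible_subset[of "{0}"]; auto)+
  fix t :: real assume t: "t \<in> {0<..}"
  \<comment> \<open>Completing the square with \<open>a+1\<close> in place of \<open>a\<close>
    leaves over the decaying factor \<open>exp (- t)\<close>; the constant of the majorant is the
    completed term.\<close>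
  have "0 \<le> (\<omega> * t / 2 - (a+1))\<^sup>2 / \<omega>" using assms by simp
  also have "\<dots> = \<omega> * (t\<^sup>2 / 4) - (a+1) * t + (a+1)\<^sup>2 / \<omega>"
    using assms by (simp add: field_simps power2_eq_square)
  also have "\<dots> \<le> \<omega> * cosh t - (a+1) * t + (a+1)\<^sup>2 / \<omega>"
    using cosh_ge_quadratic[of t] t assms by simp
  finally have "- \<omega> * cosh t + a * t \<le> (a+1)\<^sup>2 / \<omega> + - 1 * t" by (simp add: algebra_simps)
  then show "norm (exp (- \<omega> * cosh t) * exp (a * t)) \<le> exp ((a+1)\<^sup>2 / \<omega>) * exp (- 1 * t)"
    by (simp flip: exp_add)
qed auto

text \<open>Bridge between the Borel integrals of the definitions and the Lebesgue integrals for
  which change of variables is stated. A continuous function on a Borel set is Borel measurable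
  there, so completing the measure does not affect its integrability.\<close>

lemma set_integrable_lborel_iff_absolutely_integrable:
  fixes f :: "real \<Rightarrow> real"
  assumes "S \<in> sets borel" "continuous_on S f"
  shows "set_integrable lborel S f \<longleftrightarrow> f absolutely_integrable_on S"
  using borel_measurable_continuous_on_indicator[OF assms] unfolding set_integrable_def
  by (subst integrable_completion) auto

text \<open>Splitting \<open>cosh (\<nu> * t)\<close> into its two exponentials gives the form in
  which the Bessel integral arises from the density: one summand for each side of the point
  1.\<close>

lemma Bessel_K_eq_integral:
  fixes \<omega> \<nu> :: real
  assumes "\<omega> > 0"
  shows "2 * Bessel_K \<nu> \<omega> = integral {0<..} (\<lambda>t. exp (- \<omega> * cosh t) * exp (\<nu> * t))
       + integral {0<..} (\<lambda>t. exp (- \<omega> * cosh t) * exp (- \<nu> * t))"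
proof -
  let ?f = "\<lambda>t. exp (- \<omega> * cosh t) * exp (\<nu> * t)"
  let ?g = "\<lambda>t. exp (- \<omega> * cosh t) * exp (- \<nu> * t)"
  have f: "?f absolutely_integrable_on {0<..}" and g: "?g absolutely_integrable_on {0<..}"
    using absolutely_integrable_Bessel_kernel[OF assms] by blast+
  have eq: "(\<lambda>t. exp (- \<omega> * cosh t) * cosh (\<nu> * t)) = (\<lambda>t. (1/2) * (?f t + ?g t))"
  proof
    fix t
    have "cosh (\<nu> * t) = (1/2) * (exp (\<nu> * t) + exp (- \<nu> * t))" by (simp add: cosh_def)
    then show "exp (- \<omega> * cosh t) * cosh (\<nu> * t) = (1/2) * (?f t + ?g t)"
      by (simp only: distrib_left mult_ac)
  qed
  have "(\<lambda>t. ?f t + ?g t) absolutely_integrable_on {0<..}"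
    using f g by (rule set_integral_add(1))
  then have "(\<lambda>t. (1/2) * (?f t + ?g t)) absolutely_integrable_on {0<..}"
    by simp
  then have "set_integrable lborel {0<..} (\<lambda>t. (1/2) * (?f t + ?g t))"
    by (subst set_integrable_lborel_iff_absolutely_integrable)
       (auto intro!: continuous_intros)
  then have "Bessel_K \<nu> \<omega> = integral {0<..} (\<lambda>t. (1/2) * (?f t + ?g t))"
    unfolding Bessel_K_def eq by (rule set_borel_integral_eq_integral)
  also have "\<dots> = (1/2) * (integral {0<..} ?f + integral {0<..} ?g)"
    using f g by (simp only: integral_mult_right integral_add set_lebesgue_integral_eq_integral(1))
  finally show ?thesis by simp
qed

lemma Bessel_K_pos:
  fixes \<omega> \<nu> :: real
  assumes "\<omega> > 0"
  shows "Bessel_K \<nu> \<omega> > 0"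
proof -
  have pos: "integral {0<..} (\<lambda>t. exp (- \<omega> * cosh t) * exp (a * t)) > 0" (is "integral _ ?f > 0") for a
  proof -
    have i: "?f integrable_on {0<..}"
      using absolutely_integrable_Bessel_kernel[OF assms] set_lebesgue_integral_eq_integral(1) by blast
    have "0 < exp (- \<omega> * cosh 1) * exp (- \<bar>a\<bar>)" by simp
    \<comment> \<open>The interval is compact inside the open half-line, and the integrand is
      bounded below on it; the factor 2 makes up for its length 1/2.\<close>
    also have "\<dots> = integral {1/2..1} (\<lambda>t::real. 2 * (exp (- \<omega> * cosh 1) * exp (- \<bar>a\<bar>)))" by simp
    also have "\<dots> \<le> integral {1/2..1} (\<lambda>t. 2 * ?f t)"
    proof (rule integral_le)
      fix t :: real assume t: "t \<in> {1/2..1}"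
      have "cosh t \<le> cosh 1" using t by (subst cosh_real_nonneg_le_iff) auto
      moreover have "- \<bar>a\<bar> \<le> a * t"
        using t abs_le_iff[of "a*t" "\<bar>a\<bar>"] by (auto simp: abs_mult mult_left_le)
      ultimately show "2 * (exp (- \<omega> * cosh 1) * exp (- \<bar>a\<bar>)) \<le> 2 * ?f t"
        using assms by (intro mult_left_mono mult_mono) auto
    qed (auto intro!: integrable_continuous_interval continuous_intros)
    also have "\<dots> = 2 * integral {1/2..1} ?f" by simp
    also have "\<dots> \<le> 2 * integral {0<..} ?f"
      using i by (intro mult_left_mono integral_subset_le)
         (auto intro!: integrable_continuous_interval continuous_intros)
    finally show ?thesis by simp
  qed
  show ?thesis using Bessel_K_eq_integral[OF assms, of \<nu>] pos[of \<nu>] pos[of "-\<nu>"] by linarith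
qed

section \<open>The density and its total mass\<close>

lemma gig_density_pos:
  assumes "\<omega> > 0" "x > 0"
  shows "gig_density lam \<omega> x > 0"
  unfolding gig_density_def using Bessel_K_pos[OF assms(1)] assms(2) by simp

lemma continuous_on_gig_density:
  "continuous_on {0<..} (gig_density lam \<omega>)"
  unfolding gig_density_def by (intro continuous_intros) auto

text \<open>The factor \<open>exp t\<close> is the Jacobian of the substitution x = exp t. As
  \<open>t\<close> may have either sign, x = exp (-t) is covered too, with \<open>lam\<close>
  replaced by \<open>- lam\<close> because \<open>cosh\<close> is even.\<close>

lemma gig_density_exp:
  fixes t :: real
  shows "exp t * gig_density lam \<omega> (exp t)
     = 1 / (2 * Bessel_K lam \<omega>) * (exp (- \<omega> * cosh t) * exp (lam * t))"
proof -
  have "exp t * exp t powr (lam - 1) = exp (lam * t)"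
    by (simp add: powr_def algebra_simps flip: exp_add)
  moreover have "- (\<omega> / 2) * (inverse (exp t) + exp t) = - \<omega> * cosh t"
    by (simp add: cosh_def exp_minus)
  moreover have "exp t * gig_density lam \<omega> (exp t) = 1 / (2 * Bessel_K lam \<omega>) *
      (exp (- (\<omega> / 2) * (inverse (exp t) + exp t)) * (exp t * exp t powr (lam - 1)))"
    by (simp only: gig_density_def mult_ac)
  ultimately show ?thesis by (simp only:)
qed

lemma image_exp_greaterThan_0: "exp ` {0::real<..} = {1<..}"
proof -
  have "x \<in> exp ` {0<..}" if "x > 1" for x :: real
    using that by (intro image_eqI[of _ _ "ln x"]) auto
  then show ?thesis by auto
qed

lemma image_exp_uminus_greaterThan_0: "(\<lambda>t. exp (- t)) ` {0::real<..} = {0<..<1}"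
proof -
  have "x \<in> (\<lambda>t. exp (- t)) ` {0<..}" if "0 < x" "x < 1" for x :: real
    using that by (intro image_eqI[of _ _ "- ln x"]) auto
  then show ?thesis by auto
qed

text \<open>The substitutions x = exp t and x = exp (-t) send the half-line to (1,oo) and (0,1). The
  two resulting integrals add up to \<open>2 * Bessel_K lam \<omega>\<close>, which the normalising
  constant cancels.\<close>

lemma gig_density_total:
  fixes lam \<omega> :: real
  assumes "\<omega> > 0"
  shows "set_integrable lborel {0<..} (gig_density lam \<omega>)"
    and "(LBINT t:{0<..}. gig_density lam \<omega> t) = 1"
proof -
  let ?d = "gig_density lam \<omega>"
  let ?k = "\<lambda>a t. exp (- \<omega> * cosh t) * exp (a * t)"
  let ?C = "1 / (2 * Bessel_K lam \<omega>)"
  have ki: "(\<lambda>t. ?C * ?k a t) absolutely_integrable_on {0<..}" for a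
    using absolutely_integrable_Bessel_kernel[OF assms, of a] by simp
  have "(\<lambda>x. \<bar>exp x\<bar> * ?d (exp x)) = (\<lambda>t. ?C * ?k lam t)"
    by (simp add: gig_density_exp)
  then have "(\<lambda>x. \<bar>exp x\<bar> * ?d (exp x)) absolutely_integrable_on {0<..} \<and>
      integral {0<..} (\<lambda>x. \<bar>exp x\<bar> * ?d (exp x)) = integral {0<..} (\<lambda>t. ?C * ?k lam t)"
    using ki[of lam] by simp
  then have 1: "?d absolutely_integrable_on {1<..} \<and> integral {1<..} ?d = integral {0<..} (\<lambda>t. ?C * ?k lam t)"
    by (subst (asm) has_absolute_integral_change_of_variables_1'[where g = exp and g' = exp])
       (auto simp: image_exp_greaterThan_0 inj_on_def intro!: derivative_eq_intros)
  have "(\<lambda>x. \<bar>- exp (-x)\<bar> * ?d (exp (-x))) = (\<lambda>t. ?C * ?k (-lam) t)"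
    by (simp add: gig_density_exp)
  then have "(\<lambda>x. \<bar>- exp (-x)\<bar> * ?d (exp (-x))) absolutely_integrable_on {0<..} \<and>
      integral {0<..} (\<lambda>x. \<bar>- exp (-x)\<bar> * ?d (exp (-x))) = integral {0<..} (\<lambda>t. ?C * ?k (-lam) t)"
    using ki[of "-lam"] by simp
  then have 2: "?d absolutely_integrable_on {0<..<1} \<and> integral {0<..<1} ?d = integral {0<..} (\<lambda>t. ?C * ?k (-lam) t)"
    by (subst (asm) has_absolute_integral_change_of_variables_1'[where g = "\<lambda>t. exp (-t)" and g' = "\<lambda>t. - exp (-t)"])
       (auto simp: image_exp_uminus_greaterThan_0 inj_on_def intro!: derivative_eq_intros)
  \<comment> \<open>Both images omit the point 1. It is added to the upper piece, where it changes
    nothing because it is a null set.\<close>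
  have S: "{0<..} = {0<..<1} \<union> insert 1 {1::real<..}" by auto
  have 3: "?d absolutely_integrable_on insert 1 {1<..}"
  proof (subst absolutely_integrable_spike_set_eq[where T = "{1<..}"])
    show "?d absolutely_integrable_on {1<..}" using 1 by simp
  qed (rule negligible_subset[of "{1}"]; auto)+
  have 4: "integral (insert 1 {1<..}) ?d = integral {1<..} ?d"
    by (rule integral_spike_set) (rule negligible_subset[of "{1}"]; auto)+
  have abs: "?d absolutely_integrable_on {0<..}"
    unfolding S using 2 3 by (intro absolutely_integrable_Un) auto
  then show int: "set_integrable lborel {0<..} ?d"
    by (subst set_integrable_lborel_iff_absolutely_integrable)
       (auto intro!: continuous_on_gig_density)
  have "(LBINT t:{0<..}. ?d t) = integral {0<..} ?d"
    using int by (rule set_borel_integral_eq_integral)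
  also have "\<dots> = integral {0<..<1} ?d + integral (insert 1 {1<..}) ?d"
  proof -
    have "{0<..<1} \<inter> insert 1 {1::real<..} = {}" by auto
    then show ?thesis
      unfolding S using 2 3 by (intro integral_Un) (auto simp: set_lebesgue_integral_eq_integral(1))
  qed
  also have "\<dots> = ?C * (integral {0<..} (?k lam) + integral {0<..} (?k (-lam)))"
    using 1 2 4 by (simp add: distrib_left)
  also have "\<dots> = 1"
    unfolding Bessel_K_eq_integral[OF assms, symmetric] using Bessel_K_pos[OF assms, of lam] by simp
  finally show "(LBINT t:{0<..}. ?d t) = 1" .
qed

section \<open>The distribution function and its inverse\<close>

lemma gig_cdf_has_field_derivative:
  assumes "\<omega> > 0" "x > 0"
  shows "(gig_cdf lam \<omega> has_field_derivative gig_density lam \<omega> x) (at x)"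
proof -
  let ?d = "gig_density lam \<omega>"
  \<comment> \<open>The fundamental theorem of calculus is applied on a compact interval that stays
    away from 0 and has \<open>x\<close> in its interior; the mass on (0,a] is a constant.\<close>
  define a b where "a = x / 2" and "b = 2 * x"
  have ab: "0 < a" "a < x" "x < b" using assms by (auto simp: a_def b_def)
  have int: "set_integrable lborel {0<..y} ?d" for y
    using gig_density_total(1)[OF assms(1)] by (rule set_integrable_subset) auto
  have cdf: "gig_cdf lam \<omega> y = integral {0<..y} ?d" for y
    unfolding gig_cdf_def by (rule set_borel_integral_eq_integral(2)[OF int])
  have eq: "gig_cdf lam \<omega> y = gig_cdf lam \<omega> a + integral {a..y} ?d" if "y \<in> {a..b}" for y
  proof -
    have "{0<..a} \<inter> {a..y} \<subseteq> {a}" by auto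
    then have neg: "negligible ({0<..a} \<inter> {a..y})" using negligible_subset negligible_sing by blast
    have "?d integrable_on {0<..a}" using set_borel_integral_eq_integral(1)[OF int] .
    moreover have "?d integrable_on {a..y}"
      by (intro integrable_continuous_interval continuous_on_subset[OF continuous_on_gig_density])
         (use ab in auto)
    ultimately have "integral ({0<..a} \<union> {a..y}) ?d = integral {0<..a} ?d + integral {a..y} ?d"
      using neg by (rule integral_Un)
    moreover have "{0<..a} \<union> {a..y} = {0<..y}" using that ab by auto
    ultimately show ?thesis by (simp only: cdf)
  qed
  have "((\<lambda>y. integral {a..y} ?d) has_real_derivative ?d x) (at x within {a..b})"
    by (intro integral_has_real_derivative continuous_on_subset[OF continuous_on_gig_density])
       (use ab in auto)
  then have "((\<lambda>y. gig_cdf lam \<omega> a + integral {a..y} ?d) has_real_derivative ?d x) (at x within {a..b})"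
    by (auto intro!: derivative_eq_intros)
  then have "(gig_cdf lam \<omega> has_field_derivative ?d x) (at x within {a..b})"
    unfolding has_field_derivative_def
  proof (rule has_derivative_transform[rotated 2])
    show "x \<in> {a..b}" using ab by simp
  qed (rule eq)
  moreover have "at x within {a..b} = at x"
    using ab by (intro at_within_interior) simp
  ultimately show ?thesis by (simp only:)
qed

lemma continuous_on_gig_cdf:
  assumes "\<omega> > 0"
  shows "continuous_on {0<..} (gig_cdf lam \<omega>)"
  using gig_cdf_has_field_derivative[OF assms]
  by (intro continuous_at_imp_continuous_on ballI DERIV_isCont) auto

lemma strict_mono_on_gig_cdf:
  assumes "\<omega> > 0"
  shows "strict_mono_on {0<..} (gig_cdf lam \<omega>)"
proof (rule strict_mono_onI)
  fix x y :: real assume xy: "x \<in> {0<..}" "y \<in> {0<..}" "x < y"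
  show "gig_cdf lam \<omega> x < gig_cdf lam \<omega> y"
  proof (rule DERIV_pos_imp_increasing[OF xy(3)])
    fix z assume "x \<le> z" "z \<le> y"
    then have "z > 0" using xy(1) by simp
    then show "\<exists>D. DERIV (gig_cdf lam \<omega>) z :> D \<and> D > 0"
      using gig_cdf_has_field_derivative[OF assms] gig_density_pos[OF assms] by blast
  qed
qed

lemma gig_quantile_gig_cdf:
  assumes "\<omega> > 0" "x > 0"
  shows "gig_quantile lam \<omega> (gig_cdf lam \<omega> x) = x"
  unfolding gig_quantile_def
  using strict_mono_on_imp_inj_on[OF strict_mono_on_gig_cdf[OF assms(1)]] assms(2)
  by (intro the_inv_into_f_f) auto

text \<open>The limits 1 at infinity and 0 at 0 follow from continuity of the set integral along
  (0,i], which increases to (0,oo), and along (0,1/(i+1)], which decreases to the empty set. The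
  intermediate value theorem does the rest.\<close>

lemma gig_cdf_surj:
  assumes "\<omega> > 0" "0 < u" "u < 1"
  shows "\<exists>x>0. gig_cdf lam \<omega> x = u"
proof -
  let ?d = "gig_density lam \<omega>"
  have U: "(\<Union>i::nat. {0<..real i}) = {0<..}" by (auto intro: real_arch_simple)
  have "(\<lambda>i. LBINT t:{0<..real i}. ?d t) \<longlonglongrightarrow> (LBINT t:(\<Union>i::nat. {0<..real i}). ?d t)"
    using gig_density_total(1)[OF assms(1)]
    by (intro set_integral_cont_up) (auto simp: U incseq_def)
  then have "(\<lambda>i. gig_cdf lam \<omega> (real i)) \<longlonglongrightarrow> 1"
    unfolding U gig_density_total(2)[OF assms(1)] gig_cdf_def .
  then have "\<forall>\<^sub>F i in sequentially. gig_cdf lam \<omega> (real i) > u"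
    using assms(3) by (rule order_tendstoD)
  then have "\<exists>i::nat. gig_cdf lam \<omega> (real i) > u \<and> i > 0"
    using eventually_gt_at_top[of 0] by (rule eventually_happens'[OF sequentially_bot eventually_conj])
  then obtain y where y: "y > 0" "gig_cdf lam \<omega> y > u" by (metis of_nat_0_less_iff)
  \<comment> \<open>\<open>Suc i\<close> matters: with \<open>i\<close> the first interval would be
    empty, since \<open>1 / 0 = 0\<close>, and the sequence would not be decreasing.\<close>
  have I: "(\<Inter>i::nat. {0<..1 / real (Suc i)}) = {}"
  proof (rule equals0I)
    fix x assume x: "x \<in> (\<Inter>i::nat. {0<..1 / real (Suc i)})"
    have "x \<in> {0<..1 / real (Suc i)}" for i using x by (rule INT_D) simp
    then have "x > 0" "x \<le> inverse (real (Suc i))" for i by (simp_all add: inverse_eq_divide)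
    with reals_Archimedean[of x] show False by (metis not_le)
  qed
  have "(\<lambda>i::nat. LBINT t:{0<..1 / real (Suc i)}. ?d t) \<longlonglongrightarrow> (LBINT t:(\<Inter>i::nat. {0<..1 / real (Suc i)}). ?d t)"
  proof (rule set_integral_cont_down[where A = "\<lambda>i. {0<..1 / real (Suc i)}" and f = ?d])
    show "decseq (\<lambda>i. {0<..1 / real (Suc i)})"
      unfolding decseq_def
    proof (intro allI impI subsetI)
      fix i j :: nat and x assume "i \<le> j" "x \<in> {0<..1 / real (Suc j)}"
      moreover from this have "1 / real (Suc j) \<le> 1 / real (Suc i)" by (intro divide_left_mono) auto
      ultimately show "x \<in> {0<..1 / real (Suc i)}" by auto
    qed
    show "set_integrable lborel {0<..1 / real (Suc 0)} ?d"
      using gig_density_total(1)[OF assms(1)] by (rule set_integrable_subset) auto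
  qed auto
  then have "(\<lambda>i::nat. gig_cdf lam \<omega> (1 / real (Suc i))) \<longlonglongrightarrow> 0"
    unfolding I gig_cdf_def by (simp add: set_lebesgue_integral_def)
  then have "\<forall>\<^sub>F i in sequentially. gig_cdf lam \<omega> (1 / real (Suc i)) < u"
    using assms(2) by (rule order_tendstoD)
  then have "\<exists>i::nat. gig_cdf lam \<omega> (1 / real (Suc i)) < u"
    by (rule eventually_happens'[OF sequentially_bot])
  then obtain x where x: "x > 0" "gig_cdf lam \<omega> x < u" by (metis of_nat_0_less_iff zero_less_Suc zero_less_divide_1_iff)
  have "x \<le> y"
  proof (rule ccontr)
    assume "\<not> x \<le> y"
    then have "gig_cdf lam \<omega> y < gig_cdf lam \<omega> x"
      using strict_mono_onD[OF strict_mono_on_gig_cdf[OF assms(1)]] y(1) by simp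
    with x(2) y(2) show False by simp
  qed
  moreover have "continuous_on {x..y} (gig_cdf lam \<omega>)"
    using continuous_on_gig_cdf[OF assms(1)] by (rule continuous_on_subset) (use x(1) in auto)
  ultimately obtain z where "x \<le> z" "z \<le> y" "gig_cdf lam \<omega> z = u"
    using IVT'[of "gig_cdf lam \<omega>" x u y] x(2) y(2) by auto
  then show ?thesis using x(1) by (intro exI[of _ z]) auto
qed

section \<open>Power series identities and the recurrences\<close>

text \<open>Multiplying a derivative by \<open>fps_X\<close> undoes its index shift, so that
  differential identities yield the recurrences at index \<open>n\<close> directly.\<close>

lemma fps_X_mult_deriv_nth:
  "(fps_X * fps_deriv F) $ n = of_nat n * (F $ n :: 'a :: comm_semiring_1)"
  by (cases n) (auto simp: fps_X_mult_nth)

lemma analytic_on_eventually_has_field_derivative: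
  assumes "f analytic_on {z}"
  shows "\<forall>\<^sub>F w in nhds z. (f has_field_derivative deriv f w) (at w)"
proof -
  obtain s where "open s" "z \<in> s" "f holomorphic_on s"
    using assms analytic_at by blast
  then show ?thesis
    unfolding eventually_nhds using holomorphic_derivI by blast
qed

text \<open>The chain rule is used for functions near 0 and carried over by uniqueness of
  expansions. Formal composition with the exponential series would require \<open>F\<close> to have
  constant term 0.\<close>

lemma fps_deriv_exp_comp:
  fixes f :: "complex \<Rightarrow> complex"
  assumes F: "f has_fps_expansion F" and B: "(\<lambda>z. exp (f z)) has_fps_expansion B"
  shows "fps_deriv B = fps_deriv F * B"
proof (rule fps_expansion_unique_complex)
  show "deriv (\<lambda>z. exp (f z)) has_fps_expansion fps_deriv B"
    using B by (rule has_fps_expansion_deriv)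
  have "\<forall>\<^sub>F z in nhds 0. deriv (\<lambda>z. exp (f z)) z = deriv f z * exp (f z)"
    using analytic_on_eventually_has_field_derivative[OF has_fps_expansion_imp_analytic_0[OF F]]
    by eventually_elim (auto intro!: DERIV_imp_deriv derivative_eq_intros)
  moreover have "(\<lambda>z. deriv f z * exp (f z)) has_fps_expansion fps_deriv F * B"
    using F B by (intro has_fps_expansion_mult has_fps_expansion_deriv)
  ultimately show "deriv (\<lambda>z. exp (f z)) has_fps_expansion fps_deriv F * B"
    using has_fps_expansion_cong[OF _ refl] by fast
qed

text \<open>Multiplying by \<open>h\<close> turns the exponent \<open>s - 1\<close> of the
  derivative back into \<open>s\<close>, so only \<open>C\<close> itself occurs. Positive real part
  keeps \<open>h z\<close> off the branch cut and away from 0.\<close>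

lemma fps_deriv_powr_comp:
  fixes h :: "complex \<Rightarrow> complex"
  assumes H: "h has_fps_expansion H" and C: "(\<lambda>z. h z powr s) has_fps_expansion C"
    and pos: "\<forall>\<^sub>F z in nhds 0. Re (h z) > 0"
  shows "H * fps_deriv C = fps_const s * (fps_deriv H * C)"
proof (rule fps_expansion_unique_complex)
  show "(\<lambda>z. h z * deriv (\<lambda>z. h z powr s) z) has_fps_expansion H * fps_deriv C"
    using H C by (intro has_fps_expansion_mult has_fps_expansion_deriv)
  have "\<forall>\<^sub>F z in nhds 0. h z * deriv (\<lambda>z. h z powr s) z = s * (deriv h z * h z powr s)"
    using analytic_on_eventually_has_field_derivative[OF has_fps_expansion_imp_analytic_0[OF H]] pos
  proof eventually_elim
    case (elim z)
    then have ne: "h z \<notin> \<real>\<^sub>\<le>\<^sub>0" "h z \<noteq> 0" by (auto simp: complex_nonpos_Reals_iff)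
    have "((\<lambda>z. h z powr s) has_field_derivative s * h z powr (s - 1) * deriv h z) (at z)"
      using has_field_derivative_powr[OF ne(1)] elim(1) by (rule DERIV_chain2)
    then have "deriv (\<lambda>z. h z powr s) z = s * h z powr (s - 1) * deriv h z"
      by (rule DERIV_imp_deriv)
    moreover have "h z * h z powr (s - 1) = h z powr s"
      using ne by (simp add: powr_diff)
    ultimately show ?case by (simp add: mult_ac)
  qed
  moreover have "(\<lambda>z. s * (deriv h z * h z powr s)) has_fps_expansion fps_const s * (fps_deriv H * C)"
    using H C by (intro has_fps_expansion_mult has_fps_expansion_deriv has_fps_expansion_const)
  ultimately show "(\<lambda>z. h z * deriv (\<lambda>z. h z powr s) z) has_fps_expansion fps_const s * (fps_deriv H * C)"
    using has_fps_expansion_cong[OF _ refl] by fast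
qed

text \<open>All four sequences are identified together by strong induction. At index
  \<open>n\<close> the order is q, a, b, c: q needs b and c below \<open>n\<close>, a needs q up to
  \<open>n\<close>, b needs q and a up to \<open>n\<close>, and c needs q up to
  \<open>n\<close>.\<close>

lemma fps_nth_eq_gig_q:
  fixes H A B C :: "complex fps" and lam \<omega> x0 :: real
  assumes "x0 \<noteq> 0"
    and H0: "H $ 0 = of_real x0"
    and B0: "B $ 0 = of_real (exp (\<omega> / 2 * (1 / x0 + x0)))"
    and C0: "C $ 0 = of_real (x0 powr (1 - lam))"
    and HA: "H * A = 1"
    and B: "fps_deriv B = fps_const (of_real (\<omega> / 2)) * (fps_deriv (A + H)) * B"
    and C: "H * fps_deriv C = fps_const (of_real (1 - lam)) * (fps_deriv H * C)"
    and H: "fps_deriv H = fps_const (of_real (2 * Bessel_K lam \<omega>)) * (B * C)"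
    and C1: "lam = 1 \<Longrightarrow> C = 1"
  shows "H $ n = of_real (gig_q lam \<omega> x0 n)"
proof -
  let ?q = "gig_q lam \<omega> x0" and ?a = "gig_a lam \<omega> x0"
    and ?b = "gig_b lam \<omega> x0" and ?c = "gig_c lam \<omega> x0"
  have q0: "?q 0 = x0" by (simp add: gig_q.simps)
  have split: "(\<Sum>i=0..n. f i) = f 0 + (\<Sum>i=1..n. f i)" for f :: "nat \<Rightarrow> complex" and n :: nat
    by (simp add: sum.atLeast_Suc_atMost)
  have "H $ n = of_real (?q n) \<and> A $ n = of_real (?a n) \<and> B $ n = of_real (?b n) \<and> C $ n = of_real (?c n)"
  proof (induction n rule: less_induct)
    case (less n)
    show ?case
    proof (cases "n = 0")
      case True
      have "H $ 0 * A $ 0 = 1" using arg_cong[OF HA, of "\<lambda>F. fps_nth F 0"] by simp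
      then have "A $ 0 = of_real (1 / x0)" using H0 assms(1) by (simp add: field_simps)
      then show ?thesis
        using True H0 B0 C0 by (simp add: gig_q.simps gig_a.simps gig_b.simps gig_c.simps)
    next
      case n: False
      have IH: "H $ i = of_real (?q i)" "A $ i = of_real (?a i)" "B $ i = of_real (?b i)"
        "C $ i = of_real (?c i)" if "i < n" for i
        using less that by auto
      have "of_nat n * H $ n = (fps_X * fps_deriv H) $ n" by (simp add: fps_X_mult_deriv_nth)
      also have "\<dots> = of_real (2 * Bessel_K lam \<omega>) * (B * C) $ (n - 1)"
        using n by (simp add: H fps_X_mult_nth)
      finally have Hn': "H $ n = of_real (2 / real n * Bessel_K lam \<omega>) * (B * C) $ (n - 1)"
        using n by (simp add: field_simps)
      have Hn: "H $ n = of_real (?q n)"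
      proof (cases "lam = 1")
        case True
        \<comment> \<open>Here \<open>C = 1\<close>, so the convolution collapses to the single
          coefficient of \<open>B\<close>.\<close>
        then show ?thesis using Hn' C1 n IH(3)[of "n - 1"] by (simp add: gig_q.simps[of _ _ _ n])
      next
        case False
        have "(B * C) $ (n - 1) = (\<Sum>i=0..n-1. of_real (?b i * ?c (n - i - 1)))"
          unfolding fps_mult_nth using n by (intro sum.cong) (auto simp: IH)
        then show ?thesis using Hn' n False by (simp add: gig_q.simps[of _ _ _ n])
      qed
      then have IHq: "H $ i = of_real (?q i)" if "i \<le> n" for i
        using IH that by (cases "i = n") auto
      \<comment> \<open>For \<open>n > 0\<close> the coefficient of \<open>H * A = 1\<close>
        vanishes, and its term \<open>i = 0\<close> is the only one that contains
        \<open>A $ n\<close>.\<close>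
      have "0 = (\<Sum>i=0..n. H $ i * A $ (n - i))"
        using n arg_cong[OF HA, of "\<lambda>F. fps_nth F n"] by (simp add: fps_mult_nth)
      also have "\<dots> = x0 * A $ n + (\<Sum>i=1..n. of_real (?q i * ?a (n - i)))"
        unfolding split H0 by (auto intro!: sum.cong simp: IH IHq)
      finally have "A $ n = of_real (- (1 / x0) * (\<Sum>i=1..n. ?q i * ?a (n - i)))"
        using assms(1) by (simp add: field_simps eq_neg_iff_add_eq_0 add.commute)
      then have An: "A $ n = of_real (?a n)"
        using n by (simp add: gig_a.simps[of _ _ _ n] q0)
      then have IHa: "A $ i = of_real (?a i)" if "i \<le> n" for i
        using IH that by (cases "i = n") auto
      have "of_nat n * B $ n = (fps_X * fps_deriv B) $ n" by (simp add: fps_X_mult_deriv_nth)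
      also have "\<dots> = (fps_const (of_real (\<omega> / 2)) * ((fps_X * fps_deriv (A + H)) * B)) $ n"
        by (simp only: B mult_ac)
      also have "\<dots> = of_real (\<omega> / 2) * (\<Sum>i=0..n. of_nat i * (A + H) $ i * B $ (n - i))"
        by (simp only: fps_mult_left_const_nth fps_mult_nth[of "_ * _" B] fps_X_mult_deriv_nth)
      also have "\<dots> = of_real (\<omega> / 2) * (\<Sum>i=1..n. of_real (real i * (?a i + ?q i) * ?b (n - i)))"
        unfolding split by (auto intro!: sum.cong simp: IH IHq IHa)
      finally have "B $ n = of_real (\<omega> / (2 * real n) * (\<Sum>i=1..n. real i * (?a i + ?q i) * ?b (n - i)))"
        using n by (simp add: field_simps)
      then have Bn: "B $ n = of_real (?b n)"
        using n by (simp add: gig_b.simps[of _ _ _ n])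
      have "H * (fps_X * fps_deriv C) = fps_const (of_real (1 - lam)) * ((fps_X * fps_deriv H) * C)"
        using C by (simp add: mult_ac) 
      from arg_cong[OF this, of "\<lambda>F. fps_nth F n"]
      have "(\<Sum>i=0..n. H $ i * (of_nat (n - i) * C $ (n - i)))
          = of_real (1 - lam) * (\<Sum>i=0..n. of_nat i * H $ i * C $ (n - i))"
        by (simp only: fps_mult_left_const_nth fps_mult_nth[of H] fps_mult_nth[of "_ * _" C] fps_X_mult_deriv_nth)
      also have "\<dots> = (\<Sum>i=1..n. of_real ((1 - lam) * (real i * ?q i * ?c (n - i))))"
        unfolding split by (auto intro!: sum.cong simp: IH IHq sum_distrib_left)
      \<comment> \<open>On this side the term \<open>i = 0\<close> carries the unknown
        \<open>C $ n\<close>; on the other side it vanished through its factor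
        \<open>i\<close>.\<close>
      also have "(\<Sum>i=0..n. H $ i * (of_nat (n - i) * C $ (n - i)))
          = x0 * of_nat n * C $ n + (\<Sum>i=1..n. of_real (?q i * (real (n - i) * ?c (n - i))))"
        unfolding split by (auto intro!: sum.cong simp: IH IHq H0)
      finally have "x0 * of_nat n * C $ n = (\<Sum>i=1..n. of_real ((1 - lam) * (real i * ?q i * ?c (n - i))
          - ?q i * (real (n - i) * ?c (n - i))))"
        by (simp add: sum_subtractf eq_diff_eq)
      \<comment> \<open>Origin of the weight in the recurrence for c: (1 - lam) i - (n - i) = (2 -
        lam) i - n.\<close>
      also have "\<dots> = of_real (\<Sum>i=1..n. real n * (((2 - lam) * real i / real n - 1) * ?q i * ?c (n - i)))"
        unfolding of_real_sum using n
        by (intro sum.cong refl arg_cong[of _ _ of_real]) (auto simp: field_simps of_nat_diff)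
      finally have "C $ n = of_real (1 / x0 * (\<Sum>i=1..n. ((2 - lam) * real i / real n - 1) * ?q i * ?c (n - i)))"
        using n assms(1) by (simp add: sum_distrib_left[symmetric] nonzero_eq_divide_eq mult.commute[of "C $ n"])
      then have "C $ n = of_real (?c n)"
        using n by (simp add: gig_c.simps[of _ _ _ n] q0)
      with Hn An Bn show ?thesis by blast
    qed
  qed
  then show ?thesis by blast
qed

lemma has_fps_expansion_eventually_sums:
  fixes F :: "'a :: {banach, real_normed_div_algebra} fps"
  assumes "f has_fps_expansion F"
  shows "\<forall>\<^sub>F z in nhds 0. (\<lambda>n. F $ n * z ^ n) sums f z"
proof -
  have "\<forall>\<^sub>F z in nhds 0. z \<in> eball 0 (fps_conv_radius F)"
    using assms by (intro eventually_nhds_in_open) (auto simp: has_fps_expansion_def zero_ereal_def)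
  moreover have "\<forall>\<^sub>F z in nhds 0. eval_fps F z = f z"
    using assms by (simp add: has_fps_expansion_def)
  ultimately show ?thesis
    by eventually_elim (metis sums_eval_fps in_eball_iff dist_0_norm dist_norm)
qed

text \<open>Passes from functions to formal series: the differential equation and the initial value
  \<open>x0\<close> supply every identity and constant term that determine the coefficients.\<close>

lemma fps_expansion_gig_ode:
  fixes h :: "complex \<Rightarrow> complex" and lam \<omega> x0 :: real
  assumes H: "h has_fps_expansion H" and h0: "h 0 = of_real x0" and x0: "x0 > 0"
    and ode: "\<forall>\<^sub>F z in nhds 0. deriv h z = of_real (2 * Bessel_K lam \<omega>) *
        (exp (of_real (\<omega> / 2) * (inverse (h z) + h z)) * h z powr of_real (1 - lam))"
  shows "H $ n = of_real (gig_q lam \<omega> x0 n)"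
proof -
  define A where "A = inverse H"
  define b where "b = (\<lambda>z. exp (of_real (\<omega> / 2) * (inverse (h z) + h z)))"
  define c where "c = (\<lambda>z. h z powr of_real (1 - lam))"
  define B where "B = fps_expansion b 0"
  define C where "C = fps_expansion c 0"
  have H0: "H $ 0 = of_real x0"
    using has_fps_expansion_imp_0_eq_fps_nth_0[OF H] h0 by simp
  have A: "(\<lambda>z. inverse (h z)) has_fps_expansion A"
    unfolding A_def using H H0 x0 by (intro has_fps_expansion_inverse) auto
  have F: "(\<lambda>z. of_real (\<omega> / 2) * (inverse (h z) + h z)) has_fps_expansion
      fps_const (of_real (\<omega> / 2)) * (A + H)"
    by (intro has_fps_expansion_mult has_fps_expansion_const has_fps_expansion_add A H)
  have "b analytic_on {0}"
    unfolding b_def using has_fps_expansion_imp_analytic_0[OF H] h0 x0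
    by (intro analytic_intros) auto
  then have B: "b has_fps_expansion B"
    unfolding B_def by (rule analytic_at_imp_has_fps_expansion_0)
  have "c analytic_on {0}"
    unfolding c_def using has_fps_expansion_imp_analytic_0[OF H] h0 x0
    by (intro analytic_intros) auto
  then have C: "c has_fps_expansion C"
    unfolding C_def by (rule analytic_at_imp_has_fps_expansion_0)
  have "isCont h 0" using H by (rule has_fps_expansion_imp_continuous)
  then have "((\<lambda>z. Re (h z)) \<longlongrightarrow> Re (h 0)) (nhds 0)"
    unfolding isCont_def tendsto_at_iff_tendsto_nhds by (rule tendsto_Re)
  then have pos: "\<forall>\<^sub>F z in nhds 0. Re (h z) > 0"
    using h0 x0 by (intro order_tendstoD) auto
  show ?thesis
  proof (rule fps_nth_eq_gig_q)
    show "B $ 0 = of_real (exp (\<omega> / 2 * (1 / x0 + x0)))"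
      using has_fps_expansion_imp_0_eq_fps_nth_0[OF B]
      by (simp add: b_def h0 exp_of_real [symmetric] inverse_eq_divide)
    show "C $ 0 = of_real (x0 powr (1 - lam))"
      using has_fps_expansion_imp_0_eq_fps_nth_0[OF C] x0
      by (simp add: c_def h0 powr_of_real del: of_real_diff)
    show "H * A = 1"
      unfolding A_def using H0 x0 by (intro inverse_mult_eq_1') auto
    show "fps_deriv B = fps_const (of_real (\<omega> / 2)) * fps_deriv (A + H) * B"
      using fps_deriv_exp_comp[OF F B[unfolded b_def]] by simp
    show "H * fps_deriv C = fps_const (of_real (1 - lam)) * (fps_deriv H * C)"
      using fps_deriv_powr_comp[OF H C[unfolded c_def] pos] .
    show "fps_deriv H = fps_const (of_real (2 * Bessel_K lam \<omega>)) * (B * C)"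
    proof (rule fps_expansion_unique_complex)
      show "deriv h has_fps_expansion fps_deriv H" using H by (rule has_fps_expansion_deriv)
      have "(\<lambda>z. of_real (2 * Bessel_K lam \<omega>) * (b z * c z)) has_fps_expansion
          fps_const (of_real (2 * Bessel_K lam \<omega>)) * (B * C)"
        by (intro has_fps_expansion_mult has_fps_expansion_const B C)
      then show "deriv h has_fps_expansion fps_const (of_real (2 * Bessel_K lam \<omega>)) * (B * C)"
        using has_fps_expansion_cong[OF ode refl] unfolding b_def c_def by fast
    qed
    show "C = 1" if "lam = 1"
    proof (rule fps_expansion_unique_complex[OF C])
      \<comment> \<open>The exponent is 0, but \<open>0 powr 0 = 0\<close>; \<open>pos\<close> rules
        out the base 0.\<close>
      have "\<forall>\<^sub>F z in nhds 0. c z = 1"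
        using pos by eventually_elim (use that in \<open>auto simp: c_def\<close>)
      from has_fps_expansion_cong[OF this refl] show "c has_fps_expansion 1" by simp
    qed
  qed (use x0 H0 in auto)
qed

section \<open>Holomorphic extension and local inversion\<close>

text \<open>The right half-plane is convex and avoids the branch cut of \<open>powr\<close>, so the
  complex density has a primitive there. On the positive reals it has the same derivative as the
  distribution function; subtracting the constant difference makes the two agree.\<close>

lemma gig_cdf_holomorphic_extension:
  fixes lam \<omega> :: real
  assumes "\<omega> > 0"
  defines "f \<equiv> (\<lambda>z. of_real (1 / (2 * Bessel_K lam \<omega>)) * z powr of_real (lam - 1) *
                   exp (- of_real (\<omega> / 2) * (inverse z + z)))"
  obtains G :: "complex \<Rightarrow> complex"
    where "\<And>z. Re z > 0 \<Longrightarrow> (G has_field_derivative f z) (at z)"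
      and "\<And>x. x > 0 \<Longrightarrow> G (of_real x) = of_real (gig_cdf lam \<omega> x)"
proof -
  let ?S = "{z. Re z > 0}"
  have S: "open ?S" "convex ?S"
    by (simp_all add: open_halfspace_Re_gt convex_halfspace_Re_gt)
  have hol: "f holomorphic_on ?S"
    unfolding f_def by (intro holomorphic_intros) (auto simp: complex_nonpos_Reals_iff)
  obtain G where "\<And>z. z \<in> ?S \<Longrightarrow> (G has_field_derivative f z) (at z within ?S)"
    using holomorphic_convex_primitive'[OF S(2,1) hol] by blast
  then have G: "(G has_field_derivative f z) (at z)" if "Re z > 0" for z
    using that S by (metis at_within_open mem_Collect_eq)
  have f_real: "f (of_real x) = of_real (gig_density lam \<omega> x)" if "x > 0" for x
    using that unfolding f_def gig_density_def
    by (simp add: powr_of_real exp_of_real [symmetric] del: of_real_diff)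
  have deriv: "((\<lambda>x. G (of_real x) - of_real (gig_cdf lam \<omega> x)) has_vector_derivative 0) (at x within {0<..})"
    if "x \<in> {0<..}" for x :: real
  proof -
    have "((\<lambda>x. G (of_real x)) has_vector_derivative f (of_real x)) (at x within {0<..})"
      using that by (intro has_vector_derivative_real_field G) auto
    moreover have "((\<lambda>x. of_real (gig_cdf lam \<omega> x)) has_vector_derivative
        complex_of_real (gig_density lam \<omega> x)) (at x within {0<..})"
      using that gig_cdf_has_field_derivative[OF assms(1)]
      by (intro has_vector_derivative_of_real)
         (auto simp flip: has_real_derivative_iff_has_vector_derivative intro: has_field_derivative_at_within)
    ultimately have "((\<lambda>x. G (of_real x) - of_real (gig_cdf lam \<omega> x)) has_vector_derivative
        f (of_real x) - of_real (gig_density lam \<omega> x)) (at x within {0<..})"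
      by (rule has_vector_derivative_diff)
    then show ?thesis using that by (simp add: f_real)
  qed
  obtain c where c: "\<And>x. x \<in> {0<..} \<Longrightarrow> G (of_real x) - of_real (gig_cdf lam \<omega> x) = c"
    using has_vector_derivative_zero_constant[OF convex_real_interval(3) deriv] by blast
  show ?thesis
  proof (rule that)
    show "((\<lambda>z. G z - c) has_field_derivative f z) (at z)" if "Re z > 0" for z
      using G[OF that] by (auto intro!: derivative_eq_intros)
    show "G (of_real x) - c = of_real (gig_cdf lam \<omega> x)" if "x > 0" for x
      using c[of x] that by (simp add: algebra_simps)
  qed
qed

theorem mainTheorem7:
  fixes lam \<omega> u0 x0 :: real
  assumes "\<omega> > 0"
    and "0 < u0" "u0 < 1"
    and "x0 = gig_quantile lam \<omega> u0"
  shows "\<forall>\<^sub>F u in nhds u0.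
           (\<lambda>n. gig_q lam \<omega> x0 n * (u - u0) ^ n) sums gig_quantile lam \<omega> u"
proof -
  let ?F = "gig_cdf lam \<omega>" and ?K = "Bessel_K lam \<omega>"
  let ?f = "\<lambda>z. of_real (1 / (2 * ?K)) * z powr of_real (lam - 1) *
                   exp (- of_real (\<omega> / 2) * (inverse z + z))"
  obtain x where "x > 0" "?F x = u0" using gig_cdf_surj[OF assms(1-3)] by blast
  then have x0: "x0 > 0" and u0: "?F x0 = u0"
    using gig_quantile_gig_cdf[OF assms(1)] assms(4) by auto
  have K: "?K > 0" using assms(1) by (rule Bessel_K_pos)
  obtain G where G: "\<And>z. Re z > 0 \<Longrightarrow> (G has_field_derivative ?f z) (at z)"
    and G_real: "\<And>x. x > 0 \<Longrightarrow> G (of_real x) = of_real (?F x)"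
    using gig_cdf_holomorphic_extension[OF assms(1)] by blast
  have S: "open {z. Re z > 0}" by (rule open_halfspace_Re_gt)
  have G_hol: "G holomorphic_on {z. Re z > 0}"
    using G by (auto simp: holomorphic_on_def field_differentiable_def intro: has_field_derivative_at_within)
  \<comment> \<open>The derivative is \<open>?f\<close> at \<open>x0\<close>, a product of three
    nonzero factors; hence \<open>G\<close> is injective on a small ball.\<close>
  have "deriv G (of_real x0) \<noteq> 0"
    using DERIV_imp_deriv[OF G[of "of_real x0"]] x0 K by auto
  from has_complex_derivative_locally_invertible[OF G_hol _ S this] x0
  obtain r where r: "r > 0" "ball (of_real x0) r \<subseteq> {z. Re z > 0}" "open (G ` ball (of_real x0) r)"
      "inj_on G (ball (of_real x0) r)"
    by auto
  let ?B = "ball (complex_of_real x0) r"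
  obtain g where g_hol: "g holomorphic_on G ` ?B"
    and dg: "\<And>z. z \<in> ?B \<Longrightarrow> deriv G z * deriv g (G z) = 1"
    and gG: "\<And>z. z \<in> ?B \<Longrightarrow> g (G z) = z"
    using holomorphic_has_inverse[OF holomorphic_on_subset[OF G_hol r(2)] open_ball r(4)] by metis
  have G0: "G (of_real x0) = of_real u0" using G_real x0 u0 by simp
  then have u0_in: "of_real u0 \<in> G ` ?B" using r(1) by (metis centre_in_ball image_eqI)
  define h where "h = (\<lambda>z. g (of_real u0 + z))"
  have "g analytic_on {of_real u0}"
    using g_hol r(3) u0_in analytic_at by blast
  then have H: "h has_fps_expansion fps_expansion g (of_real u0)"
    unfolding h_def by (rule analytic_at_imp_has_fps_expansion)
  have h0: "h 0 = of_real x0" using gG[of "of_real x0"] r(1) G0 by (simp add: h_def)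
  have "\<forall>\<^sub>F z in nhds 0. of_real u0 + z \<in> G ` ?B"
  proof -
    have "((\<lambda>z. of_real u0 + z) \<longlongrightarrow> of_real u0 + 0) (nhds (0::complex))"
      by (intro tendsto_intros filterlim_ident)
    then show ?thesis using r(3) u0_in by (auto dest: topological_tendstoD)
  qed
  then have ode: "\<forall>\<^sub>F z in nhds 0. deriv h z = of_real (2 * ?K) *
      (exp (of_real (\<omega> / 2) * (inverse (h z) + h z)) * h z powr of_real (1 - lam))"
  proof eventually_elim
    case (elim w)
    then obtain z where z: "z \<in> ?B" "G z = of_real u0 + w" by (metis imageE)
    have hw: "h w = z" using gG z by (simp add: h_def flip: z(2))
    have Re: "Re z > 0" using z(1) r(2) by auto
    have "(g has_field_derivative deriv g (of_real u0 + w)) (at (w + of_real u0))"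
      using holomorphic_derivI[OF g_hol r(3) elim, of UNIV] by (simp add: add.commute)
    then have "(h has_field_derivative deriv g (of_real u0 + w)) (at w)"
      unfolding h_def DERIV_shift by (simp add: add.commute)
    then have "deriv h w = deriv g (G z)" using z(2) by (simp add: DERIV_imp_deriv)
    \<comment> \<open>The inverse function rule: taking the reciprocal of the density flips the sign
      in the exponential and turns \<open>lam - 1\<close> into \<open>1 - lam\<close>, which is the
      differential equation for \<open>h\<close>.\<close>
    also have "\<dots> = inverse (?f z)"
      using dg[OF z(1)] DERIV_imp_deriv[OF G[OF Re]] by (metis inverse_unique)
    also have "\<dots> = of_real (2 * ?K) * (exp (of_real (\<omega> / 2) * (inverse z + z)) * inverse (z powr of_real (lam - 1)))"
    proof -
      have "inverse (of_real (1 / (2 * ?K))) = complex_of_real (2 * ?K)"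
        by (simp add: inverse_eq_divide)
      then show ?thesis
        by (simp only: mult_minus_left mult_minus_right exp_minus inverse_mult_distrib inverse_inverse_eq mult_ac)
    qed
    also have "inverse (z powr of_real (lam - 1)) = z powr of_real (1 - lam)"
      by (metis minus_diff_eq of_real_minus powr_minus)
    finally show ?case by (simp only: hw)
  qed
  have q: "fps_expansion g (of_real u0) $ n = of_real (gig_q lam \<omega> x0 n)" for n
    using H h0 x0 ode by (rule fps_expansion_gig_ode)
  \<comment> \<open>Restricts the complex expansion at 0 to real arguments near
    \<open>u0\<close>.\<close>
  have "((\<lambda>u. complex_of_real (u - u0)) \<longlongrightarrow> of_real (u0 - u0)) (nhds u0)"
    by (intro tendsto_intros filterlim_ident)
  then have sums: "\<forall>\<^sub>F u in nhds u0. (\<lambda>n. of_real (gig_q lam \<omega> x0 n) * of_real (u - u0) ^ n) sums h (of_real (u - u0))"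
    using eventually_compose_filterlim[OF has_fps_expansion_eventually_sums[OF H]] by (simp add: q)
  \<comment> \<open>The radius keeps [x0 - e, x0 + e] inside both the ball where \<open>g\<close>
    inverts \<open>G\<close> and the positive reals. Each \<open>u\<close> near \<open>u0\<close> is
    the value of the distribution function at some point of this interval, and both \<open>g\<close>
    and the quantile function return that point.\<close>
  define e where "e = min r x0 / 2"
  have e: "0 < e" "e < r" "e < x0" using r(1) x0 by (auto simp: e_def min_def)
  have "?F (x0 - e) < u0" "u0 < ?F (x0 + e)"
    using strict_mono_onD[OF strict_mono_on_gig_cdf[OF assms(1)]] e x0 unfolding u0[symmetric] by auto
  then have "\<forall>\<^sub>F u in nhds u0. u \<in> {?F (x0 - e)<..<?F (x0 + e)}"
    by (intro eventually_nhds_in_open) auto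
  then have "\<forall>\<^sub>F u in nhds u0. h (of_real (u - u0)) = of_real (gig_quantile lam \<omega> u)"
  proof eventually_elim
    case (elim u)
    have "continuous_on {x0 - e..x0 + e} ?F"
      using continuous_on_gig_cdf[OF assms(1)] by (rule continuous_on_subset) (use e in auto)
    then obtain x where x: "x0 - e \<le> x" "x \<le> x0 + e" "?F x = u"
      using IVT'[of ?F "x0 - e" u "x0 + e"] elim e by auto
    then have "x > 0" "of_real x \<in> ?B" using e by (auto simp: dist_of_real dist_real_def)
    then show ?case
      using gG[of "of_real x"] G_real[of x] gig_quantile_gig_cdf[OF assms(1)] x(3)
      by (auto simp: h_def)
  qed
  with sums show ?thesis
  proof eventually_elim
    case (elim u)
    then have "(\<lambda>n. complex_of_real (gig_q lam \<omega> x0 n * (u - u0) ^ n)) sums of_real (gig_quantile lam \<omega> u)"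
      by simp
    then show ?case by (simp only: sums_of_real_iff)
  qed
qed

end
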